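(* Define square matrices $G_{0,q}$ and $G_{1,q}$ of size $2^q\times 2^q$ with entries in $\mathbb{Z}[x,y]$ recursively for integers $q\ge 0$ by $G_{0,0}=\begin{bmatrix}1\end{bmatrix}$, $G_{1,0}=\begin{bmatrix}0\end{bmatrix}$, and, in block form with blocks of size $2^q\times 2^q$ (where $\mathbf{0}$ is the zero block), \[ G_{0,q+1}=\begin{bmatrix} G_{0,q}+G_{1,q} & xG_{0,q}\\ G_{0,q} & \mathbf{0}\end{bmatrix},\qquad G_{1,q+1}=\begin{bmatrix} yG_{0,q} & \mathbf{0}\\ \mathbf{0} & \mathbf{0}\end{bmatrix}. \] Then for all positive integers $m,n$, the polynomial profile $D_{m,n}(x,y)$ of Domineering on an $m\times n$ board is the $(1,1)$ entry of $G_{0,n}^m$.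
   Context: An $m\times n$ board is a rectangular grid of unit squares with $m$ rows and $n$ columns. A Domineering position on the board is a set of pairwise non-overlapping dominoes placed on the board, each domino covering exactly two squares sharing an edge; Left's dominoes are vertical (two squares in the same column, in consecutive rows) and Right's dominoes are horizontal (two squares in the same row, in consecutive columns). Alternating play is not assumed, so any such set of dominoes (including the empty set) is a position. The polynomial profile (generating polynomial) is $D_{m,n}(x,y)=\sum_{a,b\ge 0} d(a,b)\,x^a y^b$, where $d(a,b)$ is the number of Domineering positions on the $m\times n$ board with exactly $a$ vertical (Left) dominoes and $b$ horizontal (Right) dominoes. *)

theory Defs
  imports
    "HOL-Computational_Algebra.Polynomial"
    "HOL-Library.Disjoint_Sets"
    "HOL-Library.Groups_Big_Fun"
    "Jordan_Normal_Form.Matrix"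
begin

text \<open>
  A cell is a pair (row, column), counted from \<open>0\<close>; a domino is the set of the two cells it covers.
\<close>

type_synonym cell = "nat \<times> nat"

definition board :: "nat \<Rightarrow> nat \<Rightarrow> cell set" where
  "board m n = {..<m} \<times> {..<n}"

definition vertical :: "cell set \<Rightarrow> bool" where
  "vertical d \<longleftrightarrow> (\<exists>i j. d = {(i, j), (Suc i, j)})"

definition horizontal :: "cell set \<Rightarrow> bool" where
  "horizontal d \<longleftrightarrow> (\<exists>i j. d = {(i, j), (i, Suc j)})"

definition domineering_position :: "nat \<Rightarrow> nat \<Rightarrow> cell set set \<Rightarrow> bool" where
  "domineering_position m n P \<longleftrightarrow>
     (\<forall>d\<in>P. d \<subseteq> board m n \<and> (vertical d \<or> horizontal d)) \<and> disjoint P"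

definition num_positions :: "nat \<Rightarrow> nat \<Rightarrow> nat \<Rightarrow> nat \<Rightarrow> nat" where
  "num_positions m n a b =
     card {P. domineering_position m n P \<and>
              card {d \<in> P. vertical d} = a \<and> card {d \<in> P. horizontal d} = b}"

text \<open>
  The ring \<open>\<int>[x, y]\<close> is rendered as \<open>\<int>[y][x]\<close>: the coefficient of \<open>x\<^sup>a y\<^sup>b\<close> in \<open>p\<close> is
  \<open>coeff (coeff p a) b\<close>.
\<close>

type_synonym bipoly = "int poly poly"

definition X :: bipoly where "X = [:0, 1:]"

definition Y :: bipoly where "Y = [:[:0, 1:]:]"

text \<open>
  \<^const>\<open>Sum_any\<close> is the sum of a finitely supported family over the whole index type. It would be
  \<open>0\<close> for an infinite support; \<open>coeff_domineering_profile\<close> below shows that this does not happen.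
\<close>

definition domineering_profile :: "nat \<Rightarrow> nat \<Rightarrow> bipoly" where
  "domineering_profile m n =
     Sum_any (\<lambda>(a, b). of_nat (num_positions m n a b) * X ^ a * Y ^ b)"

lemma finite_domineering_positions: "finite {P. domineering_position m n P}"
proof (rule finite_subset)
  show "{P. domineering_position m n P} \<subseteq> Pow (Pow (board m n))"
    by (auto simp: domineering_position_def)
  show "finite (Pow (Pow (board m n)))"
    by (simp add: board_def)
qed

lemma finite_num_positions_support: "finite {(a, b). num_positions m n a b \<noteq> 0}"
proof (rule finite_subset)
  let ?f = "\<lambda>P. (card {d \<in> P. vertical d}, card {d \<in> P. horizontal d})"
  show "{(a, b). num_positions m n a b \<noteq> 0} \<subseteq> ?f ` {P. domineering_position m n P}"
    by (auto simp: num_positions_def card_eq_0_iff)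
  show "finite (?f ` {P. domineering_position m n P})"
    using finite_domineering_positions by simp
qed

lemma X_power_Y_power: "of_nat k * X ^ a * Y ^ b = monom (monom (int k) b) a"
proof -
  have X: "X ^ a = monom 1 a"
    by (simp add: X_def monom_altdef)
  have Y: "Y ^ b = [:monom 1 b:]"
    by (induction b) (simp_all add: Y_def monom_Suc one_pCons)
  show ?thesis
    by (simp add: X Y of_nat_poly smult_monom mult.commute)
qed

lemma coeff_domineering_profile:
  "coeff (coeff (domineering_profile m n) a) b = int (num_positions m n a b)"
proof -
  let ?S = "{(a, b). num_positions m n a b \<noteq> 0}"
  let ?g = "\<lambda>(a, b). of_nat (num_positions m n a b) * X ^ a * Y ^ b"
  have "domineering_profile m n = sum ?g ?S"
    unfolding domineering_profile_def
    by (rule Sum_any.expand_superset) (use finite_num_positions_support in auto)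
  also have "\<dots> = (\<Sum>(a, b)\<in>?S. monom (monom (int (num_positions m n a b)) b) a)"
    by (simp only: X_power_Y_power)
  finally have "coeff (coeff (domineering_profile m n) a) b =
      (\<Sum>p\<in>?S. if p = (a, b) then int (num_positions m n a b) else 0)"
    by (auto simp: coeff_sum split_def intro!: sum.cong split: if_splits)
  also have "\<dots> = int (num_positions m n a b)"
    using finite_num_positions_support[of m n] by (simp add: sum.delta)
  finally show ?thesis .
qed

fun G0 :: "nat \<Rightarrow> bipoly mat" and G1 :: "nat \<Rightarrow> bipoly mat" where
  "G0 0 = 1\<^sub>m 1"
| "G1 0 = 0\<^sub>m 1 1"
| "G0 (Suc q) = four_block_mat
     (G0 q + G1 q) (X \<cdot>\<^sub>m G0 q)
     (G0 q)        (0\<^sub>m (2 ^ q) (2 ^ q))"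
| "G1 (Suc q) = four_block_mat
     (Y \<cdot>\<^sub>m G0 q)           (0\<^sub>m (2 ^ q) (2 ^ q))
     (0\<^sub>m (2 ^ q) (2 ^ q)) (0\<^sub>m (2 ^ q) (2 ^ q))"

lemma G_carrier: "G0 q \<in> carrier_mat (2 ^ q) (2 ^ q)" "G1 q \<in> carrier_mat (2 ^ q) (2 ^ q)"
  by (induction q) (auto simp: mult_2)

end

theory Submission imports Defs
begin

text \<open>
  The generating polynomial of placements is considered on arbitrary finite sets of cells. A cell of
  the set is empty, or it is covered by one of the dominoes containing it, which gives a recurrence.
  Removing the last row of a board cell by cell, from the last column to the first, the only dominoes
  to consider are the vertical one into the previous row and the horizontal one towards column \<open>0\<close>;
  these choices are exactly the block recursion of \<^const>\<open>G0\<close> and \<^const>\<open>G1\<close>. Bit \<open>j\<close> of a row index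
  says that column \<open>j\<close> of the current row is already covered by a vertical domino, bit \<open>j\<close> of a
  column index that such a domino covers column \<open>j\<close> of the previous row. Hence \<^term>\<open>G0 n\<close> is the
  transfer matrix of a row, and the entry at \<open>(0, 0)\<close> selects the absence of dominoes that cross the
  two outer borders.
\<close>

section \<open>Domino placements and their generating polynomial\<close>

definition domino :: "cell set \<Rightarrow> bool" where
  "domino d \<longleftrightarrow> vertical d \<or> horizontal d"

definition placements :: "cell set \<Rightarrow> cell set set set" where
  "placements S = {P. (\<forall>d\<in>P. d \<subseteq> S \<and> domino d) \<and> disjoint P}"

definition weight :: "cell set \<Rightarrow> bipoly" where
  "weight d = (if vertical d then X else Y)"

definition placement_sum :: "cell set \<Rightarrow> bipoly" where
  "placement_sum S = (\<Sum>P\<in>placements S. \<Prod>d\<in>P. weight d)"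

lemma domino_nonempty: "domino d \<Longrightarrow> d \<noteq> {}"
  by (auto simp: domino_def vertical_def horizontal_def)

lemma vertical_not_horizontal: "vertical d \<Longrightarrow> \<not> horizontal d"
  by (auto simp: vertical_def horizontal_def doubleton_eq_iff)

lemma placements_subset: "placements S \<subseteq> Pow (Pow S)"
  by (auto simp: placements_def)

lemma finite_placements: "finite S \<Longrightarrow> finite (placements S)"
  by (rule finite_subset[OF placements_subset]) simp

lemma finite_placement: "finite S \<Longrightarrow> P \<in> placements S \<Longrightarrow> finite P"
  using placements_subset by (blast intro: finite_subset finite_Pow_iff[THEN iffD2])

lemma placement_sum_empty: "placement_sum {} = 1"
proof -
  have "placements {} = {{}}"
    using domino_nonempty by (fastforce simp: placements_def)
  then show ?thesis
    by (simp add: placement_sum_def)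
qed

text \<open>No domino is both vertical and horizontal, so each placement contributes one monomial
  whose exponents count its dominoes of either kind; each coefficient of the sum is then a number of
  placements.\<close>

lemma domineering_profile_eq: "domineering_profile m n = placement_sum (board m n)"
proof (intro poly_eqI)
  fix a b
  let ?v = "\<lambda>P. card {d \<in> P. vertical d}" and ?h = "\<lambda>P. card {d \<in> P. horizontal d}"
  let ?S = "placements (board m n)"
  have fin: "finite (board m n)"
    by (simp add: board_def)
  have S: "P \<in> ?S \<longleftrightarrow> domineering_position m n P" for P
    by (simp add: placements_def domineering_position_def domino_def)
  have w: "(\<Prod>d\<in>P. weight d) = monom (monom 1 (?h P)) (?v P)" if "P \<in> ?S" for P
  proof -
    have eq: "P \<inter> {d. vertical d} = {d \<in> P. vertical d}"
        "P \<inter> - {d. vertical d} = {d \<in> P. horizontal d}"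
      using that vertical_not_horizontal by (auto simp: placements_def domino_def)
    have "(\<Prod>d\<in>P. weight d) = X ^ ?v P * Y ^ ?h P"
      unfolding weight_def using finite_placement[OF fin that]
      by (simp add: prod.If_cases eq)
    then show ?thesis
      using X_power_Y_power[of 1 "?v P" "?h P"] by simp
  qed
  have "coeff (coeff (placement_sum (board m n)) a) b
      = (\<Sum>P\<in>?S. if ?v P = a \<and> ?h P = b then 1 else 0)"
    unfolding placement_sum_def coeff_sum by (intro sum.cong) (auto simp: w)
  also have "\<dots> = int (card {P \<in> ?S. ?v P = a \<and> ?h P = b})"
    using finite_placements[OF fin] by (simp add: sum.If_cases Int_def)
  also have "\<dots> = coeff (coeff (domineering_profile m n) a) b"
    by (simp add: coeff_domineering_profile num_positions_def S)
  finally show "coeff (coeff (domineering_profile m n) a) b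
      = coeff (coeff (placement_sum (board m n)) a) b" ..
qed

section \<open>Recurrence at a single cell\<close>

text \<open>Either \<open>c\<close> stays empty, or it lies in some domino \<open>d\<close> of the
  placement; disjointness then confines all other dominoes to \<open>S - d\<close>.\<close>

lemma placements_cell:
  assumes "c \<in> S"
  shows "placements S = placements (S - {c}) \<union>
    (\<Union>d\<in>{d. domino d \<and> c \<in> d \<and> d \<subseteq> S}. insert d ` placements (S - d))"
    (is "_ = ?R")
proof (intro equalityI subsetI)
  fix P assume P: "P \<in> placements S"
  show "P \<in> ?R"
  proof (cases "\<exists>d\<in>P. c \<in> d")
    case True
    then obtain d where d: "d \<in> P" "c \<in> d" by blast
    have disj: "e \<inter> d = {}" if "e \<in> P - {d}" for e
      using P d that unfolding placements_def disjoint_def by blast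
    have "P - {d} \<in> placements (S - d)"
      using P disj unfolding placements_def disjoint_def by blast
    moreover have "P = insert d (P - {d})"
      using d by blast
    moreover have "domino d" "d \<subseteq> S"
      using P d by (auto simp: placements_def)
    ultimately show ?thesis
      using d by blast
  next
    case False
    then show ?thesis
      using P by (auto simp: placements_def)
  qed
next
  fix P assume "P \<in> ?R"
  then consider "P \<in> placements (S - {c})"
    | d Q where "domino d" "d \<subseteq> S" "Q \<in> placements (S - d)" "P = insert d Q"
    by auto
  then show "P \<in> placements S"
  proof cases
    case 2
    then have "e \<inter> d = {}" if "e \<in> Q" for e
      using that unfolding placements_def by blast
    with 2 show ?thesis
      unfolding placements_def disjoint_def by blast
  qed (auto simp: placements_def)
qed

lemma placement_sum_cell:
  assumes "finite S" "c \<in> S"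
  shows "placement_sum S = placement_sum (S - {c}) +
    (\<Sum>d\<in>{d. domino d \<and> c \<in> d \<and> d \<subseteq> S}. weight d * placement_sum (S - d))"
proof -
  let ?D = "{d. domino d \<and> c \<in> d \<and> d \<subseteq> S}"
  let ?w = "\<lambda>P. \<Prod>d\<in>P. weight d"
  have finD: "finite ?D"
    by (rule finite_subset[of _ "Pow S"]) (use assms in auto)
  have notin: "d \<notin> P" if "d \<in> ?D" "P \<in> placements (S - d)" for d P
    using that domino_nonempty by (auto simp: placements_def)
  have c: "c \<notin> \<Union>P" if "c \<in> d" "P \<in> placements (S - d)" for d P
    using that by (auto simp: placements_def)
  have fin: "finite (insert d ` placements (S - d))" for d
    using assms by (simp add: finite_placements)
  have ins: "(\<Sum>P\<in>insert d ` placements (S - d). ?w P) = weight d * placement_sum (S - d)"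
    if d: "d \<in> ?D" for d
  proof -
    have "inj_on (insert d) (placements (S - d))"
      using notin[OF d] by (intro inj_onI) (metis insert_ident)
    then have "(\<Sum>P\<in>insert d ` placements (S - d). ?w P)
        = (\<Sum>P\<in>placements (S - d). ?w (insert d P))"
      by (simp add: sum.reindex)
    also have "\<dots> = (\<Sum>P\<in>placements (S - d). weight d * ?w P)"
      using notin[OF d] finite_placement[of "S - d"] assms(1) by (intro sum.cong) auto
    finally show ?thesis
      by (simp add: placement_sum_def sum_distrib_left)
  qed
  have "placements (S - {c}) \<inter> (\<Union>d\<in>?D. insert d ` placements (S - d)) = {}"
    by (auto simp: placements_def)
  then have "placement_sum S = placement_sum (S - {c}) +
      (\<Sum>P\<in>(\<Union>d\<in>?D. insert d ` placements (S - d)). ?w P)"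
    unfolding placement_sum_def placements_cell[OF assms(2)]
    using assms(1) finD fin by (intro sum.union_disjoint) (auto simp: finite_placements)
  also have "(\<Sum>P\<in>(\<Union>d\<in>?D. insert d ` placements (S - d)). ?w P)
      = (\<Sum>d\<in>?D. \<Sum>P\<in>insert d ` placements (S - d). ?w P)"
  proof (intro sum.UNION_disjoint ballI impI)
    fix d e assume de: "d \<in> ?D" "e \<in> ?D" "d \<noteq> e"
    show "insert d ` placements (S - d) \<inter> insert e ` placements (S - e) = {}"
    proof (rule ccontr)
      assume "insert d ` placements (S - d) \<inter> insert e ` placements (S - e) \<noteq> {}"
      then obtain P Q where "insert d P = insert e Q" "P \<in> placements (S - d)"
          "Q \<in> placements (S - e)" by auto
      \<comment> \<open>As \<open>d\<close> and \<open>e\<close> differ, \<open>e\<close> belongs to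
        \<open>P\<close> and covers \<open>c\<close>, although \<open>P\<close> avoids all cells of
        \<open>d\<close>.\<close>
      then show False
        using c[of d P] de by blast
    qed
  qed (use finD fin in auto)
  finally show ?thesis
    using ins by simp
qed

section \<open>Removing a row cell by cell\<close>

text \<open>Of the four dominoes through the cell, the absent neighbours below and to the right rule
  out two.\<close>

lemma placement_sum_corner:
  assumes "finite S" "(i, j) \<in> S" "(Suc i, j) \<notin> S" "(i, Suc j) \<notin> S"
  shows "placement_sum S = placement_sum (S - {(i, j)}) +
    (if i > 0 \<and> (i - 1, j) \<in> S
     then X * placement_sum (S - {(i - 1, j), (i, j)}) else 0) +
    (if j > 0 \<and> (i, j - 1) \<in> S
     then Y * placement_sum (S - {(i, j - 1), (i, j)}) else 0)"
proof -
  let ?D = "{d. domino d \<and> (i, j) \<in> d \<and> d \<subseteq> S}"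
  let ?v = "{(i - 1, j), (i, j)}" and ?h = "{(i, j - 1), (i, j)}"
  \<comment> \<open>The guards \<open>i > 0\<close> and \<open>j > 0\<close> matter: truncated
    subtraction would otherwise turn the pair into the single cell \<open>(i, j)\<close>.\<close>
  let ?A = "if i > 0 \<and> (i - 1, j) \<in> S then {?v} else {}"
  let ?B = "if j > 0 \<and> (i, j - 1) \<in> S then {?h} else {}"
  have v: "vertical ?v" if "i > 0"
    using that by (cases i) (auto simp: vertical_def)
  have h: "horizontal ?h" if "j > 0"
    using that by (cases j) (auto simp: horizontal_def)
  have nv: "\<not> vertical ?h" if "j > 0"
    using h that vertical_not_horizontal by blast
  have "?D \<subseteq> ?A \<union> ?B"
  proof
    fix d assume d: "d \<in> ?D"
    then consider k l where "d = {(k, l), (Suc k, l)}" | k l where "d = {(k, l), (k, Suc l)}"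
      by (auto simp only: domino_def vertical_def horizontal_def mem_Collect_eq)
    then show "d \<in> ?A \<union> ?B"
    proof cases
      case (1 k l)
      then have "i = Suc k" "j = l"
        using d assms(3) by auto
      with 1 show ?thesis
        using d by simp
    next
      case (2 k l)
      then have "i = k" "j = Suc l"
        using d assms(4) by auto
      with 2 show ?thesis
        using d by simp
    qed
  qed
  moreover have "?A \<union> ?B \<subseteq> ?D"
    using assms(2) v h by (auto simp: domino_def)
  ultimately have D: "?D = ?A \<union> ?B"
    by (rule equalityI)
  have "?A \<inter> ?B = {}"
    by (auto simp: doubleton_eq_iff)
  then have "(\<Sum>d\<in>?D. weight d * placement_sum (S - d)) =
      (\<Sum>d\<in>?A. weight d * placement_sum (S - d)) + (\<Sum>d\<in>?B. weight d * placement_sum (S - d))"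
    unfolding D by (intro sum.union_disjoint) auto
  moreover have "(\<Sum>d\<in>?A. weight d * placement_sum (S - d)) =
      (if i > 0 \<and> (i - 1, j) \<in> S then X * placement_sum (S - ?v) else 0)"
    using v by (simp add: weight_def)
  moreover have "(\<Sum>d\<in>?B. weight d * placement_sum (S - d)) =
      (if j > 0 \<and> (i, j - 1) \<in> S then Y * placement_sum (S - ?h) else 0)"
    using nv by (simp add: weight_def)
  ultimately show ?thesis
    by (simp only: placement_sum_cell[OF assms(1,2)] add.assoc)
qed

text \<open>
  Row \<open>m\<close> is the one being removed, and \<open>R\<close> is its set of columns already covered from row \<open>m + 1\<close>.
  \<open>T\<close> is the set of columns in which a vertical domino protrudes from row \<open>m\<close> into row \<open>m - 1\<close>;
  row \<open>0\<close> has no previous row, hence the value \<open>0\<close> there unless \<open>T\<close> is empty.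
\<close>

definition frontier_sum :: "nat \<Rightarrow> nat \<Rightarrow> nat \<Rightarrow> nat set \<Rightarrow> nat set \<Rightarrow> bipoly" where
  "frontier_sum n m q T R = (if m = 0 \<and> T \<noteq> {} then 0
     else placement_sum (board m n - {m - 1} \<times> T \<union> {m} \<times> ({..<q} - R)))"

lemma frontier_sum_occupied: "frontier_sum n m (Suc q) T (insert q R) = frontier_sum n m q T R"
proof -
  have "{..<Suc q} - insert q R = {..<q} - R"
    by auto
  then show ?thesis
    by (simp add: frontier_sum_def)
qed

text \<open>The cell \<open>(m, q)\<close> is the last one left in row \<open>m\<close>, hence a
  corner. The three terms correspond to leaving it empty, covering it vertically, which records
  \<open>q\<close> in \<open>T\<close>, and covering it together with column
  \<open>q - 1\<close>.\<close>

lemma frontier_sum_free: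
  assumes "q < n" "q \<notin> R" "q \<notin> T"
  shows "frontier_sum n m (Suc q) T R = frontier_sum n m q T R
    + X * frontier_sum n m q (insert q T) R
    + (if q > 0 \<and> q - 1 \<notin> R then Y * frontier_sum n m (q - 1) T R else 0)"
proof (cases "m = 0 \<and> T \<noteq> {}")
  case False
  define S where "S = board m n - {m - 1} \<times> T \<union> {m} \<times> ({..<Suc q} - R)"
  have "finite S" "(m, q) \<in> S" "(Suc m, q) \<notin> S" "(m, Suc q) \<notin> S"
    using assms by (auto simp: S_def board_def)
  note corner = placement_sum_corner[OF this]
  have "S - {(m, q)} = board m n - {m - 1} \<times> T \<union> {m} \<times> ({..<q} - R)"
    by (auto simp: S_def board_def)
  then have empty: "placement_sum (S - {(m, q)}) = frontier_sum n m q T R"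
    using False by (simp only: frontier_sum_def if_False)
  \<comment> \<open>For \<open>m = 0\<close> both sides vanish, the right one by the default value,
    since \<open>insert q T\<close> is nonempty.\<close>
  have vertical: "(if m > 0 \<and> (m - 1, q) \<in> S then X * placement_sum (S - {(m - 1, q), (m, q)}) else 0)
      = X * frontier_sum n m q (insert q T) R"
  proof (cases "m = 0")
    case False
    then have "(m - 1, q) \<in> S"
      using assms by (auto simp: S_def board_def)
    moreover have "S - {(m - 1, q), (m, q)}
        = board m n - {m - 1} \<times> insert q T \<union> {m} \<times> ({..<q} - R)"
      using False by (auto simp: S_def board_def)
    ultimately show ?thesis
      using False by (simp add: frontier_sum_def)
  qed (simp add: frontier_sum_def)
  have mem: "(q > 0 \<and> (m, q - 1) \<in> S) \<longleftrightarrow> q > 0 \<and> q - 1 \<notin> R"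
    by (auto simp: S_def board_def)
  have "S - {(m, q - 1), (m, q)}
      = board m n - {m - 1} \<times> T \<union> {m} \<times> ({..<q - 1} - R)" if "q > 0"
    using that by (auto simp: S_def board_def)
  then have horizontal: "placement_sum (S - {(m, q - 1), (m, q)}) = frontier_sum n m (q - 1) T R"
    if "q > 0"
    using False that by (simp only: frontier_sum_def if_False)
  have "frontier_sum n m (Suc q) T R = placement_sum S"
    using False by (simp only: frontier_sum_def S_def if_False)
  then show ?thesis
    using horizontal by (simp only: corner empty vertical mem cong: if_cong conj_cong)
qed (auto simp: frontier_sum_def)

section \<open>Binary indices and block halves\<close>

definition bits :: "nat \<Rightarrow> nat set" where
  "bits r = {i. bit r i}"

lemma bits_less: "r < 2 ^ q \<Longrightarrow> i \<in> bits r \<Longrightarrow> i < q"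
  by (metis bits_def mem_Collect_eq bit_take_bit_iff take_bit_nat_eq_self)

lemma bits_0: "bits 0 = {}"
  by (simp add: bits_def)

text \<open>Bit \<open>q\<close> of \<open>r\<close> is clear, so the addition has no carry. Thus
  the second half of the block indices marks column \<open>q\<close>.\<close>

lemma bits_add_power:
  assumes "r < 2 ^ q"
  shows "bits (r + 2 ^ q) = insert q (bits r)"
proof -
  have "\<not> bit r q"
    using bits_less[OF assms, of q] by (auto simp: bits_def)
  then have "r + 2 ^ q = set_bit q r"
    by (simp add: set_bit_eq)
  then show ?thesis
    by (auto simp: bits_def bit_set_bit_iff)
qed

lemma sum_power2_split:
  "(\<Sum>s<2 ^ Suc q. f s) = (\<Sum>s<2 ^ q. f s) + (\<Sum>s<2 ^ q. f (s + 2 ^ q))"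
  for f :: "nat \<Rightarrow> 'a::comm_monoid_add"
proof -
  have "(\<Sum>s<2 ^ Suc q. f s) = (\<Sum>s\<in>{..<2 ^ q}. f s) + (\<Sum>s\<in>{2 ^ q..<2 ^ q + 2 ^ q}. f s)"
    by (subst sum.union_disjoint[symmetric]) (auto simp: mult_2 intro!: sum.cong)
  then show ?thesis
    using sum.shift_bounds_nat_ivl[of f 0 "2 ^ q" "2 ^ q"] by (simp add: atLeast0LessThan)
qed


section \<open>The block matrices as transfer matrices of a row\<close>

lemma G0_entries:
  assumes "r < 2 ^ q" "s < 2 ^ q"
  shows "G0 (Suc q) $$ (r, s) = G0 q $$ (r, s) + G1 q $$ (r, s)"
    "G0 (Suc q) $$ (r, s + 2 ^ q) = X * G0 q $$ (r, s)"
    "G0 (Suc q) $$ (r + 2 ^ q, s) = G0 q $$ (r, s)"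
    "G0 (Suc q) $$ (r + 2 ^ q, s + 2 ^ q) = 0"
  using assms G_carrier[of q] by auto

lemma G1_entries:
  assumes "r < 2 ^ q" "s < 2 ^ q"
  shows "G1 (Suc q) $$ (r, s) = Y * G0 q $$ (r, s)"
    "G1 (Suc q) $$ (r, s + 2 ^ q) = 0"
    "G1 (Suc q) $$ (r + 2 ^ q, s) = 0"
    "G1 (Suc q) $$ (r + 2 ^ q, s + 2 ^ q) = 0"
  using assms G_carrier[of q] by auto

text \<open>Both claims need a joint induction, because each recursion step of \<open>G0\<close>
  uses \<open>G1\<close> and conversely. \<open>G1 q\<close> accounts for a horizontal domino on
  columns \<open>q - 1\<close> and \<open>q\<close>. The set \<open>T\<close> holds the protruding
  columns already chosen at positions \<open>q\<close> and beyond; it is arbitrary because the step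
  also needs \<open>insert q T\<close>.\<close>

lemma transfer_row:
  assumes "q \<le> n" "r < 2 ^ q" "\<And>t. t \<in> T \<Longrightarrow> q \<le> t"
  shows "(\<Sum>s<2 ^ q. G0 q $$ (r, s) * frontier_sum n m 0 (T \<union> bits s) {})
      = frontier_sum n m q T (bits r)"
    and "(\<Sum>s<2 ^ q. G1 q $$ (r, s) * frontier_sum n m 0 (T \<union> bits s) {})
      = (if q > 0 \<and> q - 1 \<notin> bits r then Y * frontier_sum n m (q - 1) T (bits r) else 0)"
  using assms
proof (induction q arbitrary: r T)
  case 0
  {
    case 1
    then show ?case
      by (simp add: bits_0 lessThan_Suc)
  next
    case 2
    then show ?case
      by (simp add: lessThan_Suc)
  }
next
  case (Suc q)
  let ?f = "\<lambda>T. frontier_sum n m 0 T {}"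
  have free_or_occupied: "r < 2 ^ q \<or> (\<exists>r'<2 ^ q. r = r' + 2 ^ q)" if "r < 2 ^ Suc q" for r :: nat
    using that by (cases "r < 2 ^ q") (auto intro!: exI[of _ "r - 2 ^ q"])
  have le: "q \<le> t" if "\<And>t. t \<in> T \<Longrightarrow> Suc q \<le> t" "t \<in> T" for t and T :: "nat set"
    using that Suc_leD by blast
  {
    case 1
    then have T: "\<And>t. t \<in> T \<Longrightarrow> q \<le> t" "\<And>t. t \<in> insert q T \<Longrightarrow> q \<le> t" "q \<notin> T"
      using le[of T] by fastforce+
    from free_or_occupied[OF 1(2)] show ?case
    proof (elim disjE exE conjE)
      \<comment> \<open>Column \<open>q\<close> is free: the upper left block gives the empty and
        the horizontal choice, the upper right block the vertical one.\<close>
      assume r: "r < 2 ^ q"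
      have "q \<notin> bits r"
        using bits_less[OF r] by blast
      have "(\<Sum>s<2 ^ Suc q. G0 (Suc q) $$ (r, s) * ?f (T \<union> bits s))
          = (\<Sum>s<2 ^ q. G0 q $$ (r, s) * ?f (T \<union> bits s))
          + (\<Sum>s<2 ^ q. G1 q $$ (r, s) * ?f (T \<union> bits s))
          + X * (\<Sum>s<2 ^ q. G0 q $$ (r, s) * ?f (insert q T \<union> bits s))"
        using r by (simp add: sum_power2_split G0_entries bits_add_power distrib_right
            sum.distrib sum_distrib_left mult.assoc del: G0.simps power_Suc)
      also have "\<dots> = frontier_sum n m (Suc q) T (bits r)"
        using 1(1) T(3) \<open>q \<notin> bits r\<close>
          Suc.IH(1)[of r T, OF _ r T(1)] Suc.IH(2)[of r T, OF _ r T(1)]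
          Suc.IH(1)[of r "insert q T", OF _ r T(2)]
        by (simp add: frontier_sum_free)
      finally show ?thesis .
    next
      \<comment> \<open>Column \<open>q\<close> is already covered from the row below, so only the
        lower left block contributes.\<close>
      fix r' :: nat assume r': "r' < 2 ^ q" "r = r' + 2 ^ q"
      have "(\<Sum>s<2 ^ Suc q. G0 (Suc q) $$ (r, s) * ?f (T \<union> bits s))
          = (\<Sum>s<2 ^ q. G0 q $$ (r', s) * ?f (T \<union> bits s))"
        using r' by (simp add: sum_power2_split G0_entries del: G0.simps power_Suc)
      also have "\<dots> = frontier_sum n m (Suc q) T (bits r)"
        using 1(1) r' Suc.IH(1)[of r' T, OF _ r'(1) T(1)]
        by (simp add: bits_add_power frontier_sum_occupied)
      finally show ?thesis .
    qed
  next
    case 2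
    then have T: "\<And>t. t \<in> T \<Longrightarrow> q \<le> t"
      using le[of T] by blast
    from free_or_occupied[OF 2(2)] show ?case
    proof (elim disjE exE conjE)
      assume r: "r < 2 ^ q"
      have "q \<notin> bits r"
        using bits_less[OF r] by blast
      have "(\<Sum>s<2 ^ Suc q. G1 (Suc q) $$ (r, s) * ?f (T \<union> bits s))
          = Y * (\<Sum>s<2 ^ q. G0 q $$ (r, s) * ?f (T \<union> bits s))"
        using r by (simp add: sum_power2_split G1_entries sum_distrib_left mult.assoc
            del: G1.simps power_Suc)
      then show ?thesis
        using 2(1) Suc.IH(1)[of r T, OF _ r T] \<open>q \<notin> bits r\<close> by simp
    next
      fix r' :: nat assume r': "r' < 2 ^ q" "r = r' + 2 ^ q"
      then show ?thesis
        by (simp add: sum_power2_split G1_entries bits_add_power del: G1.simps power_Suc)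
    qed
  }
qed

section \<open>Iteration over the rows\<close>

text \<open>This iterates a linear recurrence of vectors. Since \<open>A ^\<^sub>m Suc k\<close> has
  its extra factor on the right, the induction hypothesis is used at \<open>Suc j\<close>.\<close>

lemma sum_pow_mat:
  fixes A :: "'a::semiring_1 mat"
  assumes A: "A \<in> carrier_mat N N"
    and step: "\<And>j r. r < N \<Longrightarrow> f (Suc j) r = (\<Sum>s<N. A $$ (r, s) * f j s)"
    and r: "r < N"
  shows "f (k + j) r = (\<Sum>s<N. (A ^\<^sub>m k) $$ (r, s) * f j s)"
proof (induction k arbitrary: j)
  case 0
  have "(\<Sum>s<N. (A ^\<^sub>m 0) $$ (r, s) * f j s) = (\<Sum>s<N. if s = r then f j s else 0)"
    using A r by (intro sum.cong) auto
  then show ?case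
    using r by simp
next
  case (Suc k)
  have "f (Suc k + j) r = (\<Sum>t<N. (A ^\<^sub>m k) $$ (r, t) * (\<Sum>s<N. A $$ (t, s) * f j s))"
    using Suc[of "Suc j"] step by simp
  also have "\<dots> = (\<Sum>s<N. (\<Sum>t<N. (A ^\<^sub>m k) $$ (r, t) * A $$ (t, s)) * f j s)"
    unfolding sum_distrib_left sum_distrib_right mult.assoc by (rule sum.swap)
  also have "\<dots> = (\<Sum>s<N. (A ^\<^sub>m Suc k) $$ (r, s) * f j s)"
    using A r by (intro sum.cong) (simp_all add: scalar_prod_def atLeast0LessThan)
  finally show ?case .
qed

theorem theorem1:
  fixes m n :: nat
  assumes "m > 0" and "n > 0"
  shows "domineering_profile m n = (G0 n ^\<^sub>m m) $$ (0, 0)"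
proof -
  \<comment> \<open>The vector for the first \<open>j\<close> rows: index \<open>r\<close> encodes
    the columns of the last of them that are covered from below.\<close>
  define f where "f j r = frontier_sum n j 0 (bits r) {}" for j r
  have step: "f (Suc j) r = (\<Sum>s<2 ^ n. G0 n $$ (r, s) * f j s)" if "r < 2 ^ n" for j r
  proof -
    \<comment> \<open>The last row, without its covered columns, is reread as a partial row
      \<open>j\<close> with all \<open>n\<close> columns still to be processed.\<close>
    have "board (Suc j) n - {j} \<times> bits r = board j n \<union> {j} \<times> ({..<n} - bits r)"
      by (auto simp: board_def)
    then have "f (Suc j) r = frontier_sum n j n {} (bits r)"
      by (simp add: f_def frontier_sum_def)
    then show ?thesis
      using transfer_row(1)[of n n r "{}" j] that by (simp add: f_def)
  qed
  \<comment> \<open>With no rows left no domino may protrude, so the initial vector is a unit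
    vector, and it selects column \<open>0\<close> of the matrix power.\<close>
  have f0: "f 0 s = (if s = 0 then 1 else 0)" for s
  proof -
    have "bits s = {} \<longleftrightarrow> s = 0"
      by (auto simp: bits_def intro: bit_eqI)
    then show ?thesis
      by (simp add: f_def frontier_sum_def board_def placement_sum_empty)
  qed
  have "domineering_profile m n = f (m + 0) 0"
    using assms by (simp add: f_def frontier_sum_def domineering_profile_eq bits_0)
  also have "\<dots> = (\<Sum>s<2 ^ n. (G0 n ^\<^sub>m m) $$ (0, s) * f 0 s)"
    using G_carrier(1) step by (intro sum_pow_mat) simp_all
  also have "\<dots> = (G0 n ^\<^sub>m m) $$ (0, 0)"
    by (simp add: f0 if_distrib[of "(*) _"] sum.delta cong: if_cong)
  finally show ?thesis .
qed

end
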